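(* Let $q$ and $q+1$ both be prime powers and let $N_\beta$ ($\beta\in\mathbb{F}_{q+1}^*$) be as in the context. Define $A_0=I_{(q+1)q^2}$, $A_1=I_{q+1}\otimes I_q\otimes(J_q-I_q)$, $A_2=I_{q+1}\otimes(J_q-I_q)\otimes J_q$, $A_3=(J_{q+1}-I_{q+1})\otimes I_{q^2}$, $A_4=(J_{q+1}-I_{q+1})\otimes I_q\otimes(J_q-I_q)$, and $A_{5,\beta}=N_\beta-A_3$ for $\beta\in\mathbb{F}_{q+1}^*$. Then $A_0,A_1,A_2,A_3,A_4,A_{5,\beta}$ ($\beta\in\mathbb{F}_{q+1}^*$) form a commutative association scheme with $q+4$ classes.
   Context: $I_n,J_n$ are the identity and all-ones matrices of order $n$, $\mathbb{F}_r^*=\mathbb{F}_r\setminus\{0\}$, $\otimes$ is the Kronecker product. Let $x$ be a new symbol and fix a bijection $\varphi:\mathbb{F}_{q+1}\to\mathbb{F}_q\cup\{x\}$ with $\varphi(0)=x$. Matrices of order $(q+1)q^2$ have rows and columns indexed by $\mathbb{F}_{q+1}\times\mathbb{F}_q\times\mathbb{F}_q$ in lexicographic order (compatible with Kronecker products). For $\beta\in\mathbb{F}_{q+1}^*$, $N_\beta$ is the $(0,1)$-matrix whose $((b,a_1,a_2),(b',a_1',a_2'))$-entry is $1$ if $c=\varphi(\beta(b'-b))$ lies in $\mathbb{F}_q$ and $a_2'-a_2=c(a_1'-a_1)$, and $0$ otherwise. A family of nonzero $(0,1)$-matrices $A_0,\dots,A_n$ indexed by a finite set $X$ forms a commutative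 association scheme with $n$ classes if: $A_0=I_{|X|}$; $\sum_iA_i=J_{|X|}$; for each $i\geq1$, $A_i^\top\in\{A_1,\dots,A_n\}$; each $A_iA_j$ is a linear combination of $A_0,\dots,A_n$; and $A_iA_j=A_jA_i$ for all $i,j$. *)

theory Defs
  imports "HOL-Analysis.Analysis" "HOL-Number_Theory.Prime_Powers"
begin

definition all_ones :: "real ^ 'n ^ 'm" where
  "all_ones = (\<chi> i j. 1)"

text \<open>
  Matrices are indexed by finite types. The rows and columns of a Kronecker product
  are indexed by the product type, so no enumeration of the indices has to be chosen.
\<close>

definition kronecker ::
    "real ^ 'n ^ 'm \<Rightarrow> real ^ 'q ^ 'p \<Rightarrow> real ^ ('n \<times> 'q) ^ ('m \<times> 'p)"
    (infixr "\<otimes>\<^sub>K" 75) where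
  "A \<otimes>\<^sub>K B = (\<chi> r s. A $ fst r $ fst s * B $ snd r $ snd s)"

text \<open>
  The matrices are indexed by an arbitrary finite set \<open>K\<close> with a distinguished element
  \<open>k0\<close> in place of \<open>{0, \<dots>, n}\<close> and \<open>0\<close>; having \<open>n\<close> classes means
  that \<open>K\<close> has \<open>n + 1\<close> elements.
\<close>

definition commutative_association_scheme ::
    "nat \<Rightarrow> 'k set \<Rightarrow> 'k \<Rightarrow> ('k \<Rightarrow> real ^ 'x ^ 'x) \<Rightarrow> bool" where
  "commutative_association_scheme n K k0 A \<longleftrightarrow>
     finite K \<and> card K = n + 1 \<and> k0 \<in> K \<and>
     (\<forall>i\<in>K. A i \<noteq> 0 \<and> (\<forall>r s. A i $ r $ s \<in> {0, 1})) \<and>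
     A k0 = mat 1 \<and>
     (\<Sum>i\<in>K. A i) = all_ones \<and>
     (\<forall>i\<in>K - {k0}. transpose (A i) \<in> A ` (K - {k0})) \<and>
     (\<forall>i\<in>K. \<forall>j\<in>K. \<exists>p :: 'k \<Rightarrow> real. A i ** A j = (\<Sum>k\<in>K. p k *\<^sub>R A k)) \<and>
     (\<forall>i\<in>K. \<forall>j\<in>K. A i ** A j = A j ** A i)"

text \<open>
  Below, \<open>'f\<close> is the field of order \<open>q\<close> and \<open>'g\<close> the field of order \<open>q + 1\<close>.
  The set \<open>'f \<union> {x}\<close> is rendered as \<open>'f option\<close>, with \<open>None\<close> for the new symbol \<open>x\<close>.
\<close>

definition N_mat ::
    "('g::{field,finite} \<Rightarrow> 'f::{field,finite} option) \<Rightarrow> 'g \<Rightarrow>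
     real ^ ('g \<times> 'f \<times> 'f) ^ ('g \<times> 'f \<times> 'f)" where
  "N_mat \<phi> \<beta> = (\<chi> r s. case (r, s) of ((b, a1, a2), (b', a1', a2')) \<Rightarrow>
     (case \<phi> (\<beta> * (b' - b)) of
        None \<Rightarrow> 0
      | Some c \<Rightarrow> if a2' - a2 = c * (a1' - a1) then 1 else 0))"

datatype 'g class_index = C0 | C1 | C2 | C3 | C4 | C5 'g

definition class_indices :: "'g::zero class_index set" where
  "class_indices = {C0, C1, C2, C3, C4} \<union> C5 ` {\<beta>. \<beta> \<noteq> 0}"

primrec class_mat ::
    "('g::{field,finite} \<Rightarrow> 'f::{field,finite} option) \<Rightarrow> 'g class_index \<Rightarrow>
     real ^ ('g \<times> 'f \<times> 'f) ^ ('g \<times> 'f \<times> 'f)" where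
  "class_mat \<phi> C0 = mat 1"
| "class_mat \<phi> C1 = mat 1 \<otimes>\<^sub>K mat 1 \<otimes>\<^sub>K (all_ones - mat 1)"
| "class_mat \<phi> C2 = mat 1 \<otimes>\<^sub>K (all_ones - mat 1) \<otimes>\<^sub>K all_ones"
| "class_mat \<phi> C3 = (all_ones - mat 1) \<otimes>\<^sub>K mat 1"
| "class_mat \<phi> C4 = (all_ones - mat 1) \<otimes>\<^sub>K mat 1 \<otimes>\<^sub>K (all_ones - mat 1)"
| "class_mat \<phi> (C5 \<beta>) = N_mat \<phi> \<beta> - (all_ones - mat 1) \<otimes>\<^sub>K mat 1"

end

theory Submission
  imports Defs
begin

text \<open>
  All matrices of the family are invariant under translation of both indices by the abelian group
  \<open>G = F\<^bsub>q+1\<^esub> \<times> F\<^sub>q \<times> F\<^sub>q\<close>, so the entries depend only on the difference \<open>g = s - r\<close>,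
  matrix products are convolutions on \<open>G\<close>, and commutativity is automatic. The classes partition
  \<open>G\<close>, and what has to be shown is that convolving two class indicators gives a function constant
  on classes. The indicators of \<open>C0, \<dots>, C4\<close> are combinations of indicators of subgroups, and
  convolving with these means summing over cosets, which preserves constancy on classes. The
  remaining case is \<open>N\<^sub>\<beta> N\<^sub>\<gamma>\<close>: for \<open>b = b\<^sub>1 + b\<^sub>2\<close> two lines of slopes
  \<open>\<phi>(\<beta> b\<^sub>1)\<close> and \<open>\<phi>(\<gamma> b\<^sub>2)\<close> meet in one point unless \<open>\<beta> b\<^sub>1 = \<gamma> b\<^sub>2\<close>, i.e.
  \<open>(\<beta> + \<gamma>) b\<^sub>1 = \<gamma> b\<close>. If \<open>\<beta> + \<gamma> \<noteq> 0\<close>, the only exception contributes \<open>N\<^sub>\<delta>\<close> with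
  \<open>\<delta> = \<beta> \<gamma> / (\<beta> + \<gamma>)\<close>; if \<open>\<beta> + \<gamma> = 0\<close>, exceptions occur exactly for \<open>b = 0\<close>.
\<close>

section \<open>Convolution on a finite abelian group\<close>

definition convolution :: "('a::{ab_group_add,finite} \<Rightarrow> real) \<Rightarrow> ('a \<Rightarrow> real) \<Rightarrow> 'a \<Rightarrow> real" where
  "convolution f h g = (\<Sum>u\<in>UNIV. f u * h (g - u))"

lemma convolution_commute: "convolution f h = convolution h f"
proof
  fix g
  show "convolution f h g = convolution h f g"
    unfolding convolution_def
    by (rule sum.reindex_bij_witness[where i = "\<lambda>u. g - u" and j = "\<lambda>u. g - u"])
       (auto simp: mult.commute)
qed

lemma convolution_diff_left:
  "convolution (\<lambda>u. f u - f' u) h = (\<lambda>g. convolution f h g - convolution f' h g)"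
  by (simp add: fun_eq_iff convolution_def left_diff_distrib sum_subtractf)

lemma matrix_mult_translation_invariant:
  fixes A B :: "real ^ 'a::{ab_group_add,finite} ^ 'a::{ab_group_add,finite}"
  assumes "\<And>r s. A $ r $ s = f (s - r)" and "\<And>r s. B $ r $ s = h (s - r)"
  shows "(A ** B) $ r $ s = convolution f h (s - r)"
  unfolding matrix_matrix_mult_def convolution_def
  by (simp add: assms)
     (rule sum.reindex_bij_witness[where i = "\<lambda>u. r + u" and j = "\<lambda>t. t - r"]; simp)

lemma sum_UNIV_triple:
  fixes f :: "'a::finite \<times> 'b::finite \<times> 'c::finite \<Rightarrow> real"
  shows "sum f UNIV = (\<Sum>a\<in>UNIV. \<Sum>b\<in>UNIV. \<Sum>c\<in>UNIV. f (a, b, c))"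
  by (simp add: sum.cartesian_product flip: UNIV_Times_UNIV)

lemma convolution_triple:
  fixes f :: "'a::{ab_group_add,finite} \<times> 'b::{ab_group_add,finite} \<times> 'c::{ab_group_add,finite} \<Rightarrow> real"
  shows "convolution f h (a, b, c) =
    (\<Sum>a1\<in>UNIV. \<Sum>b1\<in>UNIV. \<Sum>c1\<in>UNIV. f (a1, b1, c1) * h (a - a1, b - b1, c - c1))"
  by (simp add: convolution_def sum_UNIV_triple)

lemma convolution_triple':
  fixes f :: "'a::{ab_group_add,finite} \<times> 'b::{ab_group_add,finite} \<times> 'c::{ab_group_add,finite} \<Rightarrow> real"
  shows "convolution f h (a, b, c) =
    (\<Sum>a1\<in>UNIV. \<Sum>b1\<in>UNIV. \<Sum>c1\<in>UNIV. f (a - a1, b - b1, c - c1) * h (a1, b1, c1))"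
  by (subst convolution_commute) (simp add: convolution_triple mult.commute)

lemma sum_delta_diff_mult:
  fixes h :: "'a::{ab_group_add,finite} \<Rightarrow> real"
  shows "(\<Sum>t\<in>UNIV. of_bool (a = t) * h t) = h a"
  by (simp add: of_bool_def if_distrib[of "\<lambda>z. z * _"] cong: if_cong)

lemma card_UNIV_minus: "card (- A) = CARD('a) - card A" for A :: "'a::finite set"
  by (simp add: Compl_eq_Diff_UNIV card_Diff_subset)

text \<open>\<open>t\<close> is the first coordinate of a common point of the line of slope
  \<open>c\<close> through the origin and the line of slope \<open>d\<close> through
  \<open>(x, y)\<close>: distinct slopes give one point, parallel lines are disjoint or
  equal.\<close>

lemma sum_lines:
  fixes c d x y :: "'f::{field,finite}"
  shows "(\<Sum>t\<in>UNIV. of_bool (y - c * t = d * (x - t)) :: real) =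
    (if c \<noteq> d then 1 else if y = c * x then real CARD('f) else 0)"
proof (cases "c = d")
  case True
  then show ?thesis by (simp add: algebra_simps)
next
  case False
  have "y - c * t = d * (x - t) \<longleftrightarrow> (y - d * x) / (c - d) = t" for t
    using False by (auto simp: field_simps)
  with False show ?thesis
    by (simp add: of_bool_def)
qed

section \<open>The class partition\<close>

locale slope_bijection =
  fixes \<phi> :: "'g::{field,finite} \<Rightarrow> 'f::{field,finite} option"
  assumes bij: "bij \<phi>" and zero: "\<phi> 0 = None"
begin

text \<open>At 0 this is the unspecified \<open>the None\<close>, so later formulas exclude that
  argument explicitly.\<close>

definition slope :: "'g \<Rightarrow> 'f" where
  "slope z = the (\<phi> z)"

definition inv_slope :: "'f \<Rightarrow> 'g" where
  "inv_slope c = inv \<phi> (Some c)"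

lemma phi_eq_None_iff: "\<phi> z = None \<longleftrightarrow> z = 0"
  using bij zero by (metis bij_pointE)

lemma phi_nonzero: "z \<noteq> 0 \<Longrightarrow> \<phi> z = Some (slope z)"
  using phi_eq_None_iff[of z] by (auto simp: slope_def)

lemma inv_slope_nonzero [simp]: "inv_slope c \<noteq> 0"
  by (metis bij bij_inv_eq_iff inv_slope_def option.distinct(1) zero)

lemma slope_inv_slope [simp]: "slope (inv_slope c) = c"
  by (metis bij bij_inv_eq_iff inv_slope_def option.sel slope_def)

lemma inv_slope_slope [simp]: "z \<noteq> 0 \<Longrightarrow> inv_slope (slope z) = z"
  by (metis bij bij_inv_eq_iff inv_slope_def phi_nonzero)

lemma slope_eq_iff: "w \<noteq> 0 \<Longrightarrow> z \<noteq> 0 \<Longrightarrow> slope w = slope z \<longleftrightarrow> w = z"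
  by (metis inv_slope_slope)

text \<open>In the last case the index is the only \<beta> with
  \<open>slope (\<beta> * b) = y / x\<close>; it is nonzero because \<open>inv_slope\<close> avoids
  0.\<close>

fun cls :: "'g \<times> 'f \<times> 'f \<Rightarrow> 'g class_index" where
  "cls (b, x, y) =
    (if b = 0 then (if x = 0 then (if y = 0 then C0 else C1) else C2)
     else if x = 0 then (if y = 0 then C3 else C4)
     else C5 (inv_slope (y / x) / b))"

lemma cls_eq_C5_iff:
  assumes "\<beta> \<noteq> 0"
  shows "cls (b, x, y) = C5 \<beta> \<longleftrightarrow> b \<noteq> 0 \<and> x \<noteq> 0 \<and> y = slope (\<beta> * b) * x"
proof (cases "b = 0 \<or> x = 0")
  case False
  then have "inv_slope (y / x) / b = \<beta> \<longleftrightarrow> inv_slope (y / x) = \<beta> * b"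
    by (auto simp: field_simps)
  also have "\<dots> \<longleftrightarrow> y / x = slope (\<beta> * b)"
    using False assms by (metis inv_slope_slope mult_eq_0_iff slope_inv_slope)
  also have "\<dots> \<longleftrightarrow> y = slope (\<beta> * b) * x"
    using False by (auto simp: field_simps)
  finally show ?thesis using False by simp
qed auto

lemma cls_in_class_indices: "cls g \<in> class_indices"
  by (cases g) (auto simp: class_indices_def)

lemma class_indices_inhabited:
  assumes "k \<in> class_indices"
  obtains g where "cls g = k"
proof -
  have "cls (0, 0, 0) = C0" "cls (0, 0, 1) = C1" "cls (0, 1, 0) = C2"
    "cls (1, 0, 0) = C3" "cls (1, 0, 1) = C4" "\<beta> \<noteq> 0 \<Longrightarrow> cls (1, 1, slope \<beta>) = C5 \<beta>" for \<beta>
    by simp_all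
  with that assms show ?thesis
    unfolding class_indices_def by blast
qed

definition class_ind :: "'g class_index \<Rightarrow> 'g \<times> 'f \<times> 'f \<Rightarrow> real" where
  "class_ind k g = of_bool (cls g = k)"

lemma class_mat_nth:
  assumes "k \<in> class_indices"
  shows "class_mat \<phi> k $ r $ s = class_ind k (s - r)"
proof -
  obtain b x y b' x' y' where rs: "r = (b, x, y)" "s = (b', x', y')"
    by (metis prod_cases3)
  show ?thesis
  proof (cases k)
    case (C5 \<beta>)
    with assms have "\<beta> \<noteq> 0" by (auto simp: class_indices_def)
    then have "class_ind k (s - r) =
        of_bool (b' - b \<noteq> 0 \<and> x' - x \<noteq> 0 \<and> y' - y = slope (\<beta> * (b' - b)) * (x' - x))"
      by (simp only: C5 class_ind_def rs diff_Pair cls_eq_C5_iff[OF \<open>\<beta> \<noteq> 0\<close>])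
    with C5 \<open>\<beta> \<noteq> 0\<close> show ?thesis
      by (cases "b = b'")
         (auto simp: rs N_mat_def kronecker_def all_ones_def mat_def zero phi_nonzero)
  qed (auto simp: rs class_ind_def kronecker_def all_ones_def mat_def)
qed

text \<open>For \<beta> \<noteq> 0 these are the entries of \<open>N_mat \<phi> \<beta>\<close> as a
  function of the index difference; \<open>b \<noteq> 0\<close> takes over the role of the value
  \<open>None\<close>.\<close>

definition line_ind :: "'g \<Rightarrow> 'g \<times> 'f \<times> 'f \<Rightarrow> real" where
  "line_ind \<beta> = (\<lambda>(b, x, y). of_bool (b \<noteq> 0 \<and> y = slope (\<beta> * b) * x))"

lemma class_ind_C5:
  assumes "\<beta> \<noteq> 0"
  shows "class_ind (C5 \<beta>) = (\<lambda>g. line_ind \<beta> g - class_ind C3 g)"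
proof
  fix g :: "'g \<times> 'f \<times> 'f"
  obtain b x y where g: "g = (b, x, y)" by (metis prod_cases3)
  show "class_ind (C5 \<beta>) g = line_ind \<beta> g - class_ind C3 g"
    unfolding class_ind_def g line_ind_def cls_eq_C5_iff[OF assms] by auto
qed

section \<open>Functions constant on the classes\<close>

text \<open>These functions form the linear span of the class indicators, so the product axiom asks
  that convolutions of indicators be of this kind.\<close>

definition class_fun :: "('g \<times> 'f \<times> 'f \<Rightarrow> real) \<Rightarrow> bool" where
  "class_fun f \<longleftrightarrow> (\<forall>g h. cls g = cls h \<longrightarrow> f g = f h)"

lemma class_fun_alt: "class_fun f \<longleftrightarrow> (\<exists>F. f = (\<lambda>g. F (cls g)))"
proof
  assume f: "class_fun f"
  have "f g = f (SOME h. cls h = cls g)" for g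
    using f someI[of "\<lambda>h. cls h = cls g" g] unfolding class_fun_def by metis
  then show "\<exists>F. f = (\<lambda>g. F (cls g))"
    by (intro exI[of _ "\<lambda>k. f (SOME h. cls h = k)"]) blast
qed (auto simp: class_fun_def)

lemma class_fun_class_ind: "class_fun (class_ind k)"
  by (simp add: class_fun_def class_ind_def)

lemma class_fun_add: "class_fun f \<Longrightarrow> class_fun h \<Longrightarrow> class_fun (\<lambda>g. f g + h g)"
  unfolding class_fun_def by metis

lemma class_fun_diff: "class_fun f \<Longrightarrow> class_fun h \<Longrightarrow> class_fun (\<lambda>g. f g - h g)"
  unfolding class_fun_def by metis

lemma class_fun_mult: "class_fun f \<Longrightarrow> class_fun h \<Longrightarrow> class_fun (\<lambda>g. f g * h g)"
  unfolding class_fun_def by metis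

lemma class_fun_const: "class_fun (\<lambda>g. c)"
  by (simp add: class_fun_def)

text \<open>Allows formulas that differ for \<open>b = 0\<close> and \<open>b \<noteq> 0\<close> to
  be glued into one class function.\<close>

lemma class_fun_fst_eq_0: "class_fun (\<lambda>g. of_bool (fst g = 0))"
proof -
  have "fst g = 0 \<longleftrightarrow> cls g \<in> {C0, C1, C2}" for g
    by (cases g) auto
  then show ?thesis by (simp add: class_fun_def)
qed

lemma class_fun_line_ind:
  assumes "\<beta> \<noteq> 0"
  shows "class_fun (line_ind \<beta>)"
proof -
  have "line_ind \<beta> = (\<lambda>g. class_ind (C5 \<beta>) g + class_ind C3 g)"
    by (simp add: class_ind_C5[OF assms])
  then show ?thesis
    by (simp add: class_fun_add class_fun_class_ind)
qed

section \<open>Sums over cosets of coordinate subgroups\<close>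

definition sum_fst :: "('g \<times> 'f \<times> 'f \<Rightarrow> real) \<Rightarrow> 'g \<times> 'f \<times> 'f \<Rightarrow> real" where
  "sum_fst f = (\<lambda>(b, x, y). \<Sum>t\<in>UNIV. f (t, x, y))"

definition sum_mid :: "('g \<times> 'f \<times> 'f \<Rightarrow> real) \<Rightarrow> 'g \<times> 'f \<times> 'f \<Rightarrow> real" where
  "sum_mid f = (\<lambda>(b, x, y). \<Sum>t\<in>UNIV. f (b, t, y))"

definition sum_snd :: "('g \<times> 'f \<times> 'f \<Rightarrow> real) \<Rightarrow> 'g \<times> 'f \<times> 'f \<Rightarrow> real" where
  "sum_snd f = (\<lambda>(b, x, y). \<Sum>t\<in>UNIV. f (b, x, t))"

text \<open>The number of points of a coset in each class depends only on the class of the starting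
  point. For \<open>b \<noteq> 0\<close> and \<open>x \<noteq> 0\<close> the quotient
  \<open>t / x\<close> runs through all slopes, so each \<open>C5 \<beta>\<close> is met exactly
  once.\<close>

lemma class_fun_sum_snd:
  assumes "class_fun f"
  shows "class_fun (sum_snd f)"
proof -
  obtain F where F: "f = (\<lambda>g. F (cls g))"
    using assms by (auto simp: class_fun_alt)
  have lines: "(\<Sum>t\<in>UNIV. F (C5 (inv_slope (t / x) / b))) = (\<Sum>\<beta>\<in>-{0}. F (C5 \<beta>))"
    if "b \<noteq> 0" "x \<noteq> 0" for b x
    by (rule sum.reindex_bij_witness[where i = "\<lambda>\<beta>. slope (\<beta> * b) * x"
          and j = "\<lambda>t. inv_slope (t / x) / b"]) (use that in auto)
  have "sum_snd f g =
      (if cls g = C0 \<or> cls g = C1 then \<Sum>t\<in>UNIV. F (if t = (0::'f) then C0 else C1)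
       else if cls g = C2 then \<Sum>t\<in>(UNIV :: 'f set). F C2
       else if cls g = C3 \<or> cls g = C4 then \<Sum>t\<in>UNIV. F (if t = (0::'f) then C3 else C4)
       else \<Sum>\<beta>\<in>-{0}. F (C5 \<beta>))" for g
    by (cases g) (simp add: sum_snd_def F lines)
  then show ?thesis
    by (simp add: class_fun_def)
qed

text \<open>For \<open>x \<noteq> 0\<close> the coset has one point in \<open>C2\<close>, at
  \<open>t = 0\<close>; elsewhere the index is \<open>d / t\<close> with
  \<open>d = inv_slope (y / x)\<close> fixed, so each \<open>C5 \<beta>\<close> is again met
  once.\<close>

lemma class_fun_sum_fst:
  assumes "class_fun f"
  shows "class_fun (sum_fst f)"
proof -
  obtain F where F: "f = (\<lambda>g. F (cls g))"
    using assms by (auto simp: class_fun_alt)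
  have lines: "(\<Sum>t\<in>UNIV. F (if t = 0 then C2 else C5 (d / t))) = F C2 + (\<Sum>\<beta>\<in>-{0}. F (C5 \<beta>))"
    if "d \<noteq> 0" for d :: 'g
  proof -
    have "(\<Sum>t\<in>UNIV. F (if t = 0 then C2 else C5 (d / t)))
        = F C2 + (\<Sum>t\<in>-{0}. F (if t = 0 then C2 else C5 (d / t)))"
      by (simp add: sum.remove[of UNIV 0] Compl_eq_Diff_UNIV)
    also have "(\<Sum>t\<in>-{0}. F (if t = 0 then C2 else C5 (d / t))) = (\<Sum>\<beta>\<in>-{0}. F (C5 \<beta>))"
      by (rule sum.reindex_bij_witness[where i = "\<lambda>\<beta>. d / \<beta>" and j = "\<lambda>t. d / t"])
         (use that in auto)
    finally show ?thesis .
  qed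
  have "sum_fst f g =
      (if cls g = C0 \<or> cls g = C3 then \<Sum>t\<in>UNIV. F (if t = (0::'g) then C0 else C3)
       else if cls g = C1 \<or> cls g = C4 then \<Sum>t\<in>UNIV. F (if t = (0::'g) then C1 else C4)
       else F C2 + (\<Sum>\<beta>\<in>-{0}. F (C5 \<beta>)))" for g
  proof -
    obtain b x y where "g = (b, x, y)" by (metis prod_cases3)
    then show ?thesis
      by (cases "x = 0"; cases "y = 0") (simp_all add: sum_fst_def F lines cong: if_cong)
  qed
  then show ?thesis
    by (simp add: class_fun_def)
qed

text \<open>After summing over \<open>y\<close> only the vanishing of \<open>b\<close> and of
  \<open>x\<close> matters, and summing over \<open>x\<close> leaves that of \<open>b\<close>.
  \<open>sum_mid\<close> alone would fail: at \<open>(b, 0, 0)\<close> with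
  \<open>b \<noteq> 0\<close> it sees the class \<open>C5 (inv_slope 0 / b)\<close>, which varies
  with \<open>b\<close>.\<close>

lemma class_fun_sum_mid_sum_snd:
  assumes "class_fun f"
  shows "class_fun (sum_mid (sum_snd f))"
proof -
  have "class_fun (sum_snd f)" using assms by (rule class_fun_sum_snd)
  then obtain F where F: "sum_snd f = (\<lambda>g. F (cls g))"
    by (auto simp: class_fun_alt)
  have "sum_snd f (b, x, y) = sum_snd f (b, x, 0)" for b x y
    by (simp add: sum_snd_def)
  moreover have "sum_snd f (b, x, 0) = (if b = 0 then F (if x = 0 then C0 else C2)
      else if x = 0 then F C3 else F (C5 1))" for b x
  proof (cases "b = 0 \<or> x = 0")
    case False
    \<comment> \<open>The coset meets every \<open>C5 \<beta>\<close>; the choice \<beta> = 1 fixes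
      a representative independent of \<open>b\<close> and \<open>x\<close>.\<close>
    then have "cls (b, x, slope b * x) = C5 1"
      by simp
    with calculation[of b x "slope b * x"] False show ?thesis
      by (simp add: F)
  qed (auto simp: F)
  ultimately have eq: "sum_snd f (b, x, y) = (if b = 0 then F (if x = 0 then C0 else C2)
      else if x = 0 then F C3 else F (C5 1))" for b x y
    by metis
  have "sum_mid (sum_snd f) g =
      of_bool (fst g = 0) * (\<Sum>t\<in>UNIV. F (if t = (0::'f) then C0 else C2)) +
      (1 - of_bool (fst g = 0)) * (\<Sum>t\<in>UNIV. if t = (0::'f) then F C3 else F (C5 1))" for g
    by (cases g) (simp add: sum_mid_def eq)
  then have "sum_mid (sum_snd f) = (\<lambda>g.
      of_bool (fst g = 0) * (\<Sum>t\<in>UNIV. F (if t = (0::'f) then C0 else C2)) +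
      (1 - of_bool (fst g = 0)) * (\<Sum>t\<in>UNIV. if t = (0::'f) then F C3 else F (C5 1)))" ..
  then show ?thesis
    by (simp only:) (intro class_fun_add class_fun_mult class_fun_diff class_fun_const class_fun_fst_eq_0)
qed

text \<open>Each indicator splits into factors in the separate coordinates: a delta at 0 keeps the
  coordinate, a constant 1 sums over it.\<close>

lemma convolution_class_ind:
  "convolution (class_ind C0) f = f"
  "convolution (class_ind C1) f = (\<lambda>g. sum_snd f g - f g)"
  "convolution (class_ind C2) f = (\<lambda>g. sum_mid (sum_snd f) g - sum_snd f g)"
  "convolution (class_ind C3) f = (\<lambda>g. sum_fst f g - f g)"
  "convolution (class_ind C4) f = (\<lambda>g. sum_fst (sum_snd f) g - sum_snd f g - (sum_fst f g - f g))"
proof -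
  have ind:
    "class_ind C0 (b, x, y) = of_bool (b = 0) * (of_bool (x = 0) * of_bool (y = 0))"
    "class_ind C1 (b, x, y) = of_bool (b = 0) * (of_bool (x = 0) * (1 - of_bool (y = 0)))"
    "class_ind C2 (b, x, y) = of_bool (b = 0) * (1 - of_bool (x = 0))"
    "class_ind C3 (b, x, y) = (1 - of_bool (b = 0)) * (of_bool (x = 0) * of_bool (y = 0))"
    "class_ind C4 (b, x, y) = (1 - of_bool (b = 0)) * (of_bool (x = 0) * (1 - of_bool (y = 0)))"
    for b x y
    by (simp_all add: class_ind_def)
  note simps = fun_eq_iff convolution_triple' ind mult.assoc left_diff_distrib sum_subtractf
    sum_delta_diff_mult sum_fst_def sum_mid_def sum_snd_def sum_distrib_left[symmetric]
  show
    "convolution (class_ind C0) f = f"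
    "convolution (class_ind C1) f = (\<lambda>g. sum_snd f g - f g)"
    "convolution (class_ind C2) f = (\<lambda>g. sum_mid (sum_snd f) g - sum_snd f g)"
    "convolution (class_ind C3) f = (\<lambda>g. sum_fst f g - f g)"
    "convolution (class_ind C4) f = (\<lambda>g. sum_fst (sum_snd f) g - sum_snd f g - (sum_fst f g - f g))"
    by (simp_all add: simps)
qed

lemma class_fun_convolution_class_ind:
  assumes "k \<in> {C0, C1, C2, C3, C4}" and "class_fun f"
  shows "class_fun (convolution (class_ind k) f)"
  using assms
  by (auto simp: convolution_class_ind intro!: class_fun_diff class_fun_sum_snd class_fun_sum_fst
      class_fun_sum_mid_sum_snd)

section \<open>Products of line indicators\<close>

text \<open>Decompositions of \<open>(b, x, y)\<close> are sorted by the first coordinate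
  \<open>t\<close> of the left summand, and \<open>sum_lines\<close> counts those for each
  \<open>t\<close>. Injectivity of \<open>slope\<close> turns equal slopes into
  \<open>\<beta> * t = \<gamma> * (b - t)\<close>.\<close>

lemma convolution_line_ind:
  assumes "\<beta> \<noteq> 0" and "\<gamma> \<noteq> 0"
  shows "convolution (line_ind \<beta>) (line_ind \<gamma>) (b, x, y) =
    (\<Sum>t\<in>-{0, b}. if \<beta> * t \<noteq> \<gamma> * (b - t) then 1
       else real CARD('f) * of_bool (y = slope (\<beta> * t) * x))"
proof -
  \<comment> \<open>Both conditions on \<open>t\<close> move into the second factor, leaving a pure
    delta in \<open>y1\<close>.\<close>
  have "convolution (line_ind \<beta>) (line_ind \<gamma>) (b, x, y) =
    (\<Sum>t\<in>UNIV. \<Sum>x1\<in>UNIV. \<Sum>y1\<in>UNIV. of_bool (slope (\<beta> * t) * x1 = y1) *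
       of_bool (t \<notin> {0, b} \<and> y - y1 = slope (\<gamma> * (b - t)) * (x - x1)))"
    unfolding convolution_triple line_ind_def
    by (intro sum.cong refl) auto
  also have "\<dots> = (\<Sum>t\<in>UNIV. \<Sum>x1\<in>UNIV.
      of_bool (t \<notin> {0, b} \<and> y - slope (\<beta> * t) * x1 = slope (\<gamma> * (b - t)) * (x - x1)))"
    by (simp only: sum_delta_diff_mult)
  also have "\<dots> = (\<Sum>t\<in>-{0, b}. \<Sum>x1\<in>UNIV.
      of_bool (y - slope (\<beta> * t) * x1 = slope (\<gamma> * (b - t)) * (x - x1)))"
    by (rule sum.mono_neutral_cong_right) auto
  also have "\<dots> = (\<Sum>t\<in>-{0, b}. if \<beta> * t \<noteq> \<gamma> * (b - t) then 1
       else real CARD('f) * of_bool (y = slope (\<beta> * t) * x))"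
    by (intro sum.cong refl) (use assms in \<open>auto simp: sum_lines slope_eq_iff\<close>)
  finally show ?thesis .
qed

lemma class_fun_convolution_line_ind:
  assumes nz: "\<beta> \<noteq> 0" "\<gamma> \<noteq> 0"
  shows "class_fun (convolution (line_ind \<beta>) (line_ind \<gamma>))"
proof (cases "\<beta> + \<gamma> = 0")
  case True
  then have \<gamma>: "\<gamma> = - \<beta>"
    by (simp add: eq_neg_iff_add_eq_0 add.commute)
  \<comment> \<open>For \<open>b = 0\<close> the slopes agree for every \<open>t\<close>; for
    \<open>b \<noteq> 0\<close> they never do, and each \<open>t\<close> outside
    \<open>{0, b}\<close> contributes 1.\<close>
  have "convolution (line_ind \<beta>) (line_ind \<gamma>) g =
      of_bool (fst g = 0) * (real CARD('f) * sum_fst (line_ind \<beta>) g) +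
      (1 - of_bool (fst g = 0)) * (real CARD('g) - 2)" for g
  proof -
    obtain b x y where g: "g = (b, x, y)" by (metis prod_cases3)
    have iff: "\<beta> * t \<noteq> \<gamma> * (b - t) \<longleftrightarrow> b \<noteq> 0" for t
      using nz by (auto simp: \<gamma> algebra_simps)
    show ?thesis
    proof (cases "b = 0")
      case True
      have "convolution (line_ind \<beta>) (line_ind \<gamma>) g =
          real CARD('f) * (\<Sum>t\<in>-{0}. of_bool (y = slope (\<beta> * t) * x))"
        unfolding g convolution_line_ind[OF nz] iff sum_distrib_left using True by simp
      also have "(\<Sum>t\<in>-{0}. of_bool (y = slope (\<beta> * t) * x) :: real) = sum_fst (line_ind \<beta>) g"
        unfolding g sum_fst_def line_ind_def prod.case
        by (rule sum.mono_neutral_cong_left) auto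
      finally show ?thesis
        using True by (simp add: g)
    next
      case False
      then have "card (- {0, b}) = CARD('g) - 2"
        by (simp add: card_UNIV_minus)
      moreover have "2 \<le> CARD('g)"
        using card_mono[of UNIV "{0, b}"] False by simp
      ultimately show ?thesis
        using False unfolding g convolution_line_ind[OF nz] iff by simp
    qed
  qed
  then have "convolution (line_ind \<beta>) (line_ind \<gamma>) = (\<lambda>g.
      of_bool (fst g = 0) * (real CARD('f) * sum_fst (line_ind \<beta>) g) +
      (1 - of_bool (fst g = 0)) * (real CARD('g) - 2))" ..
  then show ?thesis
    by (simp only:) (intro class_fun_add class_fun_mult class_fun_diff class_fun_const
        class_fun_fst_eq_0 class_fun_sum_fst class_fun_line_ind nz)
next
  case False
  define \<delta> where "\<delta> = \<beta> * \<gamma> / (\<beta> + \<gamma>)"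
  have \<delta>: "\<delta> \<noteq> 0" using False nz by (simp add: \<delta>_def)
  \<comment> \<open>For \<open>b = 0\<close> the exceptional \<open>t0\<close> is 0, already
    excluded, so all nonzero \<open>t\<close> contribute 1. For \<open>b \<noteq> 0\<close> the
    points 0, \<open>b\<close>, \<open>t0\<close> are distinct, which gives the 3, and
    \<open>t0\<close> contributes the line term.\<close>
  have "convolution (line_ind \<beta>) (line_ind \<gamma>) g =
      of_bool (fst g = 0) * (real CARD('g) - 1) +
      (1 - of_bool (fst g = 0)) * (real CARD('g) - 3 + real CARD('f) * line_ind \<delta> g)" for g
  proof -
    obtain b x y where g: "g = (b, x, y)" by (metis prod_cases3)
    define t0 where "t0 = \<gamma> * b / (\<beta> + \<gamma>)"
    have iff: "\<beta> * t \<noteq> \<gamma> * (b - t) \<longleftrightarrow> t \<noteq> t0" for t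
      using False by (auto simp: t0_def field_simps)
    show ?thesis
    proof (cases "b = 0")
      case True
      then have "(\<Sum>t\<in>-{0, b}. if t \<noteq> t0 then 1
          else real CARD('f) * of_bool (y = slope (\<beta> * t) * x)) = (\<Sum>t\<in>-{0::'g}. 1)"
        by (intro sum.cong) (auto simp: t0_def)
      then show ?thesis
        unfolding g convolution_line_ind[OF nz] iff
        using True by (simp add: card_UNIV_minus of_nat_diff)
    next
      case b: False
      have t0: "t0 \<in> - {0, b}"
        using b nz False by (auto simp: t0_def field_simps)
      have card: "3 \<le> CARD('g)"
        using card_mono[of UNIV "{0, t0, b}"] b t0 by simp
      have "- {0, b} - {t0} = - {0, t0, b}" by auto
      then have "card (- {0, b} - {t0}) = CARD('g) - 3"
        using b t0 by (simp add: card_UNIV_minus)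
      \<comment> \<open>The common slope at \<open>t0\<close> is thus the one that \<delta> assigns
        to \<open>b\<close>.\<close>
      moreover have "\<beta> * t0 = \<delta> * b"
        by (simp add: t0_def \<delta>_def)
      ultimately show ?thesis
        using b card unfolding g convolution_line_ind[OF nz] iff
        by (simp add: sum.remove[OF _ t0] line_ind_def of_nat_diff)
    qed
  qed
  then have "convolution (line_ind \<beta>) (line_ind \<gamma>) = (\<lambda>g.
      of_bool (fst g = 0) * (real CARD('g) - 1) +
      (1 - of_bool (fst g = 0)) * (real CARD('g) - 3 + real CARD('f) * line_ind \<delta> g))" ..
  then show ?thesis
    by (simp only:) (intro class_fun_add class_fun_mult class_fun_diff class_fun_const
        class_fun_fst_eq_0 class_fun_line_ind \<delta>)
qed

lemma class_fun_convolution: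
  assumes "i \<in> class_indices" and "j \<in> class_indices"
  shows "class_fun (convolution (class_ind i) (class_ind j))"
proof -
  consider "i \<in> {C0, C1, C2, C3, C4}" | "j \<in> {C0, C1, C2, C3, C4}"
    | \<beta> \<gamma> where "i = C5 \<beta>" "\<beta> \<noteq> 0" "j = C5 \<gamma>" "\<gamma> \<noteq> 0"
    using assms by (auto simp: class_indices_def)
  then show ?thesis
  proof cases
    case 1
    then show ?thesis by (intro class_fun_convolution_class_ind class_fun_class_ind)
  next
    case 2
    then show ?thesis
      by (subst convolution_commute) (intro class_fun_convolution_class_ind class_fun_class_ind)
  next
    case 3
    \<comment> \<open>Both factors are expanded as line indicator minus \<open>class_ind C3\<close>;
      commuting puts \<open>class_ind C3\<close> on the left, where closure is known.\<close>
    have "convolution (class_ind i) (class_ind j) =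
        (\<lambda>g. convolution (class_ind j) (line_ind \<beta>) g - convolution (class_ind C3) (class_ind j) g)"
      unfolding \<open>i = C5 \<beta>\<close> class_ind_C5[OF \<open>\<beta> \<noteq> 0\<close>] convolution_diff_left
      by (simp add: convolution_commute)
    also have "\<dots> = (\<lambda>g. convolution (line_ind \<gamma>) (line_ind \<beta>) g
        - convolution (class_ind C3) (line_ind \<beta>) g - convolution (class_ind C3) (class_ind j) g)"
      by (simp only: 3 class_ind_C5[OF \<open>\<gamma> \<noteq> 0\<close>] convolution_diff_left)
    finally show ?thesis
      using 3 by (auto intro!: class_fun_diff class_fun_convolution_line_ind
          class_fun_convolution_class_ind class_fun_line_ind class_fun_class_ind)
  qed
qed

section \<open>The association scheme\<close>

text \<open>Transposition negates the difference: \<open>y / x\<close> is unchanged while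
  \<open>b\<close> changes sign, so \<beta> becomes -\<beta>; the other classes are
  symmetric.\<close>

lemma transpose_class_mat:
  assumes "i \<in> class_indices - {C0}"
  shows "transpose (class_mat \<phi> i) \<in> class_mat \<phi> ` (class_indices - {C0})"
proof -
  define i' where "i' = (case i of C5 \<beta> \<Rightarrow> C5 (- \<beta>) | _ \<Rightarrow> i)"
  have i': "i' \<in> class_indices - {C0}"
    using assms by (cases i) (auto simp: i'_def class_indices_def)
  have "cls (- g) = i \<longleftrightarrow> cls g = i'" for g
  proof -
    obtain b x y where g: "g = (b, x, y)" by (metis prod_cases3)
    show ?thesis
      using assms by (cases i) (auto simp: g i'_def class_indices_def)
  qed
  from this[of "s - r" for r s]
  have "class_ind i (r - s) = class_ind i' (s - r)" for r s
    by (simp add: class_ind_def)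
  then have "transpose (class_mat \<phi> i) = class_mat \<phi> i'"
    using assms i' by (simp add: vec_eq_iff transpose_def class_mat_nth)
  with i' show ?thesis by blast
qed

lemma finite_class_indices: "finite (class_indices :: 'g class_index set)"
  by (simp add: class_indices_def)

lemma card_class_indices: "card (class_indices :: 'g class_index set) = CARD('g) + 4"
proof -
  have "card (C5 ` {\<beta>::'g. \<beta> \<noteq> 0}) = CARD('g) - 1"
    by (subst card_image) (auto simp: inj_on_def Collect_neg_eq card_UNIV_minus)
  moreover have "CARD('g) > 0" by simp
  moreover have "{C0, C1, C2, C3, C4} \<inter> C5 ` {\<beta>::'g. \<beta> \<noteq> 0} = {}" by auto
  ultimately show ?thesis
    unfolding class_indices_def by (subst card_Un_disjoint) auto
qed

text \<open>The coefficients of a class function are its values on the classes; constant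
  coefficients 1 give the all-ones matrix.\<close>

lemma sum_class_ind:
  "(\<Sum>k\<in>class_indices. p k * class_ind k g) = p (cls g)"
  using cls_in_class_indices[of g]
  by (simp add: class_ind_def of_bool_def if_distrib[of "\<lambda>z. _ * z"] finite_class_indices
      cong: if_cong)

lemma commutative_association_scheme_class_mat:
  "commutative_association_scheme (CARD('g) + 3) class_indices C0 (class_mat \<phi>)"
  unfolding commutative_association_scheme_def
proof (intro conjI ballI)
  show "C0 \<in> (class_indices :: 'g class_index set)"
    by (simp add: class_indices_def)
  show "card (class_indices :: 'g class_index set) = CARD('g) + 3 + 1"
    by (simp add: card_class_indices)
  show "(\<Sum>i\<in>class_indices. class_mat \<phi> i) = all_ones"
    using sum_class_ind[of "\<lambda>_. 1"]
    by (simp add: vec_eq_iff all_ones_def class_mat_nth)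
next
  fix i :: "'g class_index" assume i: "i \<in> class_indices"
  obtain g where "cls g = i" using class_indices_inhabited[OF i] .
  \<comment> \<open>In row 0 the index difference is \<open>g\<close> itself.\<close>
  then have "class_mat \<phi> i $ 0 $ g = 1"
    by (simp add: class_mat_nth[OF i] class_ind_def)
  then show "class_mat \<phi> i \<noteq> 0" by auto
  show "\<forall>r s. class_mat \<phi> i $ r $ s \<in> {0, 1}"
    by (simp add: class_mat_nth[OF i] class_ind_def)
  fix j :: "'g class_index" assume j: "j \<in> class_indices"
  note nth = class_mat_nth[OF i] class_mat_nth[OF j]
  show "class_mat \<phi> i ** class_mat \<phi> j = class_mat \<phi> j ** class_mat \<phi> i"
    by (simp add: vec_eq_iff matrix_mult_translation_invariant[OF nth]
        matrix_mult_translation_invariant[OF nth(2,1)] convolution_commute)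
  obtain p where p: "convolution (class_ind i) (class_ind j) = (\<lambda>g. p (cls g))"
    using class_fun_convolution[OF i j] by (auto simp: class_fun_alt)
  have "class_mat \<phi> i ** class_mat \<phi> j = (\<Sum>k\<in>class_indices. p k *\<^sub>R class_mat \<phi> k)"
    by (simp add: vec_eq_iff matrix_mult_translation_invariant[OF nth] p class_mat_nth sum_class_ind)
  then show "\<exists>p. class_mat \<phi> i ** class_mat \<phi> j = (\<Sum>k\<in>class_indices. p k *\<^sub>R class_mat \<phi> k)"
    by (intro exI[of _ p])
qed (simp_all add: finite_class_indices transpose_class_mat del: Diff_iff)

end

theorem theorem4p3:
  fixes q :: nat
    and \<phi> :: "'g::{field,finite} \<Rightarrow> 'f::{field,finite} option"
  assumes "primepow q" and "primepow (q + 1)"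
    and "CARD('f) = q" and "CARD('g) = q + 1"
    and "bij \<phi>" and "\<phi> 0 = None"
  shows "commutative_association_scheme (q + 4) class_indices C0 (class_mat \<phi>)"
proof -
  interpret slope_bijection \<phi>
    using assms by unfold_locales
  show ?thesis
    using commutative_association_scheme_class_mat assms by (simp add: add.commute)
qed

end
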